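(* Let $M$ be a contact manifold with contact structure $\mathcal{D}$, let $\varkappa = D(M)/\mathcal{D}$, and let $\mathrm{Sym}\,\mathcal{D}$ be the Lie algebra of infinitesimal symmetries (contact vector fields) of $\mathcal{D}$. Then the $\mathbb{R}$-linear map $$\mathrm{Sym}\,\mathcal{D}\to\varkappa,\qquad Z\mapsto Z \ (\mathrm{mod}\ \mathcal{D}),$$ is bijective.
   Context: All manifolds, vector fields, etc. are smooth. $D(M)$ denotes the $C^\infty(M)$-module of vector fields on $M$. A (regular) distribution on $M$ is identified with the $C^\infty(M)$-module $\mathcal{D}\subset D(M)$ of vector fields belonging to it (a projective submodule whose values at the points $x\in M$ form a vector subbundle $x\mapsto\mathcal{D}_x\subset T_xM$ of constant rank). Put $\varkappa := D(M)/\mathcal{D}$, the module of sections of the normal bundle $TM/\mathcal{D}$. The curvature of $\mathcal{D}$ is the $C^\infty(M)$-bilinear skew-symmetric form $R:\mathcal{D}\times\mathcal{D}\to\varkappa$, $R(X,Y) = [X,Y] \ (\mathrm{mod}\ \mathcal{D})$. If $\mathcal{D}$ has codimension 1, it is called nondegenerate if $\mathcal{D}\to\mathrm{Hom}_{C^\infty(M)}(\mathcal{D},\varkappa)$, $X\mapsto R(X,\cdot)$, is an isomorphism of $C^\infty(M)$-modules. A contact manifold is a manifold $M$ supplied with a nondegenerate distribution $\mathcal{D}$ of codimension 1, which is called a contact structure. An infinitesimal symmetry of $\mathcal{D}$ is a vector field $Z\in D(M)$ such that $[X,Z]\in\mathcal{D}$ for all $X\in\mathcal{D}$; these form the Lie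 subalgebra $\mathrm{Sym}\,\mathcal{D}\subset D(M)$. *)

theory Defs
  imports "HOL-Analysis.Analysis" "HOL-Algebra.Module" "HOL-Algebra.AbelCoset"
begin

section \<open>Smooth manifolds and smooth functions\<close>

text \<open>
  \<open>Ck_on k S f\<close>, for an open set \<open>S\<close>: the function \<open>f\<close> is of class \<open>C^k\<close> on \<open>S\<close>, i.e. all
  iterated directional derivatives of order at most \<open>k\<close> exist (as derivatives of Frechet
  differentiable functions) and are continuous.
\<close>

fun Ck_on :: "nat \<Rightarrow> 'e::euclidean_space set \<Rightarrow> ('e \<Rightarrow> 'f::real_normed_vector) \<Rightarrow> bool" where
  "Ck_on 0 S f \<longleftrightarrow> continuous_on S f"
| "Ck_on (Suc k) S f \<longleftrightarrow>
     (\<forall>x\<in>S. f differentiable (at x)) \<and> (\<forall>v. Ck_on k S (\<lambda>x. frechet_derivative f (at x) v))"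

definition smooth_on :: "'e::euclidean_space set \<Rightarrow> ('e \<Rightarrow> 'f::real_normed_vector) \<Rightarrow> bool" where
  "smooth_on S f \<longleftrightarrow> (\<forall>k. Ck_on k S f)"

text \<open>
  The points of a manifold are the elements of a type \<open>'a\<close> that is Hausdorff and second countable.
  A chart is a pair \<open>(U, \<phi>)\<close> with values in the Euclidean space \<open>'e\<close>, so the dimension of the
  manifold is \<open>DIM('e)\<close>; the values of \<open>\<phi>\<close> outside \<open>U\<close> are irrelevant, and the inverse
  chart is \<open>inv_into U \<phi>\<close>. A smooth structure is given by an atlas that need not be maximal.
\<close>

type_synonym ('a, 'e) chart = "'a set \<times> ('a \<Rightarrow> 'e)"

definition smooth_manifold ::
  "('a::{t2_space, second_countable_topology}, 'e::euclidean_space) chart set \<Rightarrow> bool" where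
  "smooth_manifold A \<longleftrightarrow>
     (\<forall>(U, \<phi>)\<in>A. open U \<and> open (\<phi> ` U) \<and> homeomorphism U (\<phi> ` U) \<phi> (inv_into U \<phi>)) \<and>
     (\<Union>(U, \<phi>)\<in>A. U) = UNIV \<and>
     (\<forall>(U, \<phi>)\<in>A. \<forall>(V, \<psi>)\<in>A. smooth_on (\<phi> ` (U \<inter> V)) (\<psi> \<circ> inv_into U \<phi>))"

definition smooth_function_on ::
  "('a::topological_space, 'e::euclidean_space) chart set \<Rightarrow> 'a set \<Rightarrow> ('a \<Rightarrow> real) \<Rightarrow> bool" where
  "smooth_function_on A W f \<longleftrightarrow> (\<forall>(U, \<phi>)\<in>A. smooth_on (\<phi> ` (U \<inter> W)) (f \<circ> inv_into U \<phi>))"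

definition smooth_functions ::
  "('a::topological_space, 'e::euclidean_space) chart set \<Rightarrow> ('a \<Rightarrow> real) ring" where
  "smooth_functions A =
     \<lparr> carrier = {f. smooth_function_on A UNIV f},
       mult = (\<lambda>f g x. f x * g x), one = (\<lambda>x. 1),
       zero = (\<lambda>x. 0), add = (\<lambda>f g x. f x + g x) \<rparr>"


section \<open>Vector fields\<close>

text \<open>
  The tangent space at \<open>x\<close> consists of the derivations at \<open>x\<close> of the algebra of smooth functions.
  Since HOL functions are total, a tangent vector is given the value \<open>0\<close> on functions that are not
  smooth; this makes it determined by its values on smooth functions.
\<close>

type_synonym 'a tangent = "('a \<Rightarrow> real) \<Rightarrow> real"

definition tangent_space ::
  "('a::topological_space, 'e::euclidean_space) chart set \<Rightarrow> 'a \<Rightarrow> 'a tangent set" where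
  "tangent_space A x = {v.
     (\<forall>f\<in>carrier (smooth_functions A). \<forall>g\<in>carrier (smooth_functions A).
        v (\<lambda>y. f y + g y) = v f + v g \<and>
        v (\<lambda>y. f y * g y) = f x * v g + g x * v f) \<and>
     (\<forall>c. \<forall>f\<in>carrier (smooth_functions A). v (\<lambda>y. c * f y) = c * v f) \<and>
     (\<forall>f. f \<notin> carrier (smooth_functions A) \<longrightarrow> v f = 0)}"

definition smooth_vector_field_on ::
  "('a::topological_space, 'e::euclidean_space) chart set \<Rightarrow> 'a set \<Rightarrow> ('a \<Rightarrow> 'a tangent) \<Rightarrow> bool"
where
  "smooth_vector_field_on A W X \<longleftrightarrow>
     (\<forall>x\<in>W. X x \<in> tangent_space A x) \<and>
     (\<forall>f\<in>carrier (smooth_functions A). smooth_function_on A W (\<lambda>x. X x f))"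

text \<open>
  The module \<open>D(M)\<close> over \<open>smooth_functions A\<close>. The fields \<open>mult\<close> and \<open>one\<close>, which every HOL-Algebra
  module record has, play no role, here and below.
\<close>

definition vector_fields ::
  "('a::topological_space, 'e::euclidean_space) chart set
     \<Rightarrow> ('a \<Rightarrow> real, 'a \<Rightarrow> 'a tangent) module" where
  "vector_fields A =
     \<lparr> carrier = {X. smooth_vector_field_on A UNIV X},
       mult = undefined, one = undefined,
       zero = (\<lambda>x f. 0), add = (\<lambda>X Y x f. X x f + Y x f),
       smult = (\<lambda>h X x f. h x * X x f) \<rparr>"

definition lie_bracket ::
  "('a \<Rightarrow> 'a tangent) \<Rightarrow> ('a \<Rightarrow> 'a tangent) \<Rightarrow> 'a \<Rightarrow> 'a tangent" where
  "lie_bracket X Y = (\<lambda>x f. X x (\<lambda>y. Y y f) - Y x (\<lambda>y. X y f))"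


section \<open>Quotient modules and modules of homomorphisms\<close>

text \<open>
  As in \<^const>\<open>a_r_coset\<close>, the coset of \<open>x\<close> modulo \<open>H\<close> is \<open>H +> x\<close>. The product of a scalar with a
  coset is the coset of the product of that scalar with any representative. (The pointwise image of
  a coset under a scalar is in general only a part of a coset.)
\<close>

definition quotient_module :: "('r, 'm) module \<Rightarrow> 'm set \<Rightarrow> ('r, 'm set) module" where
  "quotient_module M H =
     \<lparr> carrier = a_rcosets\<^bsub>M\<^esub> H,
       mult = undefined, one = undefined,
       zero = H, add = set_add M,
       smult = (\<lambda>a C. \<Union>x\<in>C. a_r_coset M H (a \<odot>\<^bsub>M\<^esub> x)) \<rparr>"

definition module_homs ::
  "'r ring \<Rightarrow> ('r, 'm) module \<Rightarrow> ('r, 'n) module \<Rightarrow> ('m \<Rightarrow> 'n) set" where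
  "module_homs R M N = {\<phi> \<in> carrier M \<rightarrow> carrier N.
     (\<forall>x\<in>carrier M. \<forall>y\<in>carrier M. \<phi> (x \<oplus>\<^bsub>M\<^esub> y) = \<phi> x \<oplus>\<^bsub>N\<^esub> \<phi> y) \<and>
     (\<forall>a\<in>carrier R. \<forall>x\<in>carrier M. \<phi> (a \<odot>\<^bsub>M\<^esub> x) = a \<odot>\<^bsub>N\<^esub> \<phi> x)}"

text \<open>
  The elements of the module \<open>Hom_R(M, N)\<close> are extensional, so that homomorphisms which agree on
  \<open>M\<close> are equal.
\<close>

definition hom_module ::
  "'r ring \<Rightarrow> ('r, 'm) module \<Rightarrow> ('r, 'n) module \<Rightarrow> ('r, 'm \<Rightarrow> 'n) module" where
  "hom_module R M N =
     \<lparr> carrier = module_homs R M N \<inter> extensional (carrier M),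
       mult = undefined, one = undefined,
       zero = (\<lambda>x\<in>carrier M. \<zero>\<^bsub>N\<^esub>),
       add = (\<lambda>\<phi> \<psi>. \<lambda>x\<in>carrier M. \<phi> x \<oplus>\<^bsub>N\<^esub> \<psi> x),
       smult = (\<lambda>a \<phi>. \<lambda>x\<in>carrier M. a \<odot>\<^bsub>N\<^esub> \<phi> x) \<rparr>"

definition module_isos ::
  "'r ring \<Rightarrow> ('r, 'm) module \<Rightarrow> ('r, 'n) module \<Rightarrow> ('m \<Rightarrow> 'n) set" where
  "module_isos R M N = {\<phi> \<in> module_homs R M N. bij_betw \<phi> (carrier M) (carrier N)}"


section \<open>Distributions and contact structures\<close>

text \<open>
  A family of subsets \<open>E x\<close> of the tangent spaces is a smooth vector subbundle of rank \<open>k\<close> if locally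
  it has a smooth frame: vector fields \<open>X 0, \<dots>, X (k - 1)\<close> whose values at \<open>y\<close> form a basis of
  \<open>E y\<close>. That they form a basis is expressed by the bijectivity of the map that sends a
  coefficient vector to the corresponding linear combination.
\<close>

definition vector_subbundle ::
  "('a::topological_space, 'e::euclidean_space) chart set \<Rightarrow> nat \<Rightarrow> ('a \<Rightarrow> 'a tangent set) \<Rightarrow> bool"
where
  "vector_subbundle A k E \<longleftrightarrow>
     (\<forall>x. \<exists>U X. open U \<and> x \<in> U \<and>
        (\<forall>i<k. smooth_vector_field_on A U (X i)) \<and>
        (\<forall>y\<in>U. bij_betw (\<lambda>c f. \<Sum>i<k. c i * X i y f) ({..<k} \<rightarrow>\<^sub>E (UNIV :: real set)) (E y)))"

definition values_at :: "('a \<Rightarrow> 'a tangent) set \<Rightarrow> 'a \<Rightarrow> 'a tangent set" where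
  "values_at D x = {X x | X. X \<in> D}"

text \<open>
  A distribution of rank \<open>k\<close>, given as the set \<open>D\<close> of all vector fields belonging to it.
\<close>

definition distribution ::
  "('a::topological_space, 'e::euclidean_space) chart set \<Rightarrow> nat \<Rightarrow> ('a \<Rightarrow> 'a tangent) set \<Rightarrow> bool"
where
  "distribution A k D \<longleftrightarrow>
     vector_subbundle A k (values_at D) \<and>
     D = {X \<in> carrier (vector_fields A). \<forall>x. X x \<in> values_at D x}"

definition distribution_module ::
  "('a::topological_space, 'e::euclidean_space) chart set \<Rightarrow> ('a \<Rightarrow> 'a tangent) set
     \<Rightarrow> ('a \<Rightarrow> real, 'a \<Rightarrow> 'a tangent) module" where
  "distribution_module A D = (vector_fields A)\<lparr>carrier := D\<rparr>"

definition normal_module ::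
  "('a::topological_space, 'e::euclidean_space) chart set \<Rightarrow> ('a \<Rightarrow> 'a tangent) set
     \<Rightarrow> ('a \<Rightarrow> real, ('a \<Rightarrow> 'a tangent) set) module" where
  "normal_module A D = quotient_module (vector_fields A) D"

definition class_mod ::
  "('a::topological_space, 'e::euclidean_space) chart set \<Rightarrow> ('a \<Rightarrow> 'a tangent) set
     \<Rightarrow> ('a \<Rightarrow> 'a tangent) \<Rightarrow> ('a \<Rightarrow> 'a tangent) set" where
  "class_mod A D Z = a_r_coset (vector_fields A) D Z"

definition curvature ::
  "('a::topological_space, 'e::euclidean_space) chart set \<Rightarrow> ('a \<Rightarrow> 'a tangent) set
     \<Rightarrow> ('a \<Rightarrow> 'a tangent) \<Rightarrow> ('a \<Rightarrow> 'a tangent) \<Rightarrow> ('a \<Rightarrow> 'a tangent) set" where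
  "curvature A D X Y = class_mod A D (lie_bracket X Y)"

definition nondegenerate ::
  "('a::topological_space, 'e::euclidean_space) chart set \<Rightarrow> ('a \<Rightarrow> 'a tangent) set \<Rightarrow> bool" where
  "nondegenerate A D \<longleftrightarrow>
     (\<lambda>X. \<lambda>Y\<in>D. curvature A D X Y) \<in>
       module_isos (smooth_functions A) (distribution_module A D)
         (hom_module (smooth_functions A) (distribution_module A D) (normal_module A D))"

definition contact_structure ::
  "('a::topological_space, 'e::euclidean_space) chart set \<Rightarrow> ('a \<Rightarrow> 'a tangent) set \<Rightarrow> bool" where
  "contact_structure A D \<longleftrightarrow>
     (\<exists>k. k + 1 = DIM('e) \<and> distribution A k D) \<and> nondegenerate A D"

definition infinitesimal_symmetries ::
  "('a::topological_space, 'e::euclidean_space) chart set \<Rightarrow> ('a \<Rightarrow> 'a tangent) set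
     \<Rightarrow> ('a \<Rightarrow> 'a tangent) set" where
  "infinitesimal_symmetries A D =
     {Z \<in> carrier (vector_fields A). \<forall>X\<in>D. lie_bracket X Z \<in> D}"

end

theory Submission
  imports Defs
begin

text \<open>
  For a vector field \<open>Z\<close>, bracketing with \<open>Z\<close> and reducing modulo \<open>D\<close> gives a map
  \<open>X \<mapsto> [Z, X] mod D\<close> on \<open>D\<close>. It is linear over the smooth functions, although the bracket itself
  is not: in \<open>[Z, h X] = h [Z, X] + Z(h) X\<close> the second term lies in \<open>D\<close>. The field \<open>Z\<close> is an
  infinitesimal symmetry exactly when this map vanishes, and for \<open>Z\<close> in \<open>D\<close> the map is the
  curvature form \<open>R(Z, \<cdot>)\<close>.

  Nondegeneracy says that every linear map from \<open>D\<close> to the normal module is \<open>R(Y, \<cdot>)\<close> for exactly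
  one \<open>Y\<close> in \<open>D\<close>. Hence every vector field \<open>Z\<close> can be corrected by exactly one \<open>Y\<close> in \<open>D\<close> so that
  \<open>Z - Y\<close> is a symmetry. Existence of \<open>Y\<close> means that every class contains a symmetry
  (\<open>class_mod_symmetries_surj\<close>). Uniqueness, applied to the difference of two symmetries in the
  same class, means that it contains only one (\<open>inj_on_class_mod_symmetries\<close>). The linearity that
  makes nondegeneracy applicable is \<open>class_mod_lie_bracket_hom\<close>.

  Analysis enters through the algebra that this presupposes: vector fields form a module over
  the ring of smooth functions and are closed under the bracket. Since tangent vectors are
  derivations, this comes down to the closure of \<open>C^k\<close> functions under sums and products.
\<close>

section \<open>The algebra of smooth functions\<close>

text \<open>
  The recursion in \<open>Ck_on\<close> passes to a directional derivative, which is a total function. The sum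
  and product rules determine it on \<open>S\<close> only, so induction on \<open>k\<close> needs that \<open>Ck_on\<close> does not see
  values outside \<open>S\<close>.
\<close>

lemma Ck_on_cong:
  assumes "open S" "\<And>x. x \<in> S \<Longrightarrow> f x = g x" "Ck_on k S f"
  shows "Ck_on k S g"
  using assms(2,3)
proof (induction k arbitrary: f g)
  case 0
  then show ?case using continuous_on_cong[of S S f g] by simp
next
  case (Suc k)
  have diff: "f differentiable (at x)" if "x \<in> S" for x
    using Suc.prems(2) that by simp
  have "g differentiable (at x)" if "x \<in> S" for x
    using diff[OF that] has_derivative_transform_within_open[of f _ x UNIV S g] assms(1) that
      Suc.prems(1) unfolding differentiable_def by blast
  moreover have "Ck_on k S (\<lambda>x. frechet_derivative g (at x) v)" for v
  proof (rule Suc.IH)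
    show "frechet_derivative f (at x) v = frechet_derivative g (at x) v" if "x \<in> S" for x
      using frechet_derivative_transform_within_open[OF diff[OF that] assms(1) that Suc.prems(1)]
      by simp
    show "Ck_on k S (\<lambda>x. frechet_derivative f (at x) v)"
      using Suc.prems(2) by simp
  qed
  ultimately show ?case by simp
qed

lemma Ck_on_Suc_imp_Ck_on: "Ck_on (Suc k) S f \<Longrightarrow> Ck_on k S f"
proof (induction k arbitrary: f)
  case 0
  then show ?case
    by (auto intro!: continuous_at_imp_continuous_on differentiable_imp_continuous_within)
next
  case (Suc k)
  then show ?case using Suc.IH by auto
qed

lemma Ck_on_const: "Ck_on k S (\<lambda>x. c)"
  by (induction k arbitrary: c) auto

lemma Ck_on_add:
  assumes "open S" "Ck_on k S f" "Ck_on k S g"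
  shows "Ck_on k S (\<lambda>x. f x + g x)"
  using assms(2,3)
proof (induction k arbitrary: f g)
  case 0
  then show ?case by (simp add: continuous_on_add)
next
  case (Suc k)
  have "Ck_on k S (\<lambda>x. frechet_derivative (\<lambda>x. f x + g x) (at x) v)" for v
  proof (rule Ck_on_cong[OF assms(1)])
    show "Ck_on k S (\<lambda>x. frechet_derivative f (at x) v + frechet_derivative g (at x) v)"
      using Suc by simp
    show "frechet_derivative f (at x) v + frechet_derivative g (at x) v
        = frechet_derivative (\<lambda>x. f x + g x) (at x) v" if "x \<in> S" for x
    proof -
      have "((\<lambda>x. f x + g x) has_derivative
          (\<lambda>v. frechet_derivative f (at x) v + frechet_derivative g (at x) v)) (at x)"
        using Suc.prems that by (intro has_derivative_add) (simp_all add: frechet_derivative_works)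
      from frechet_derivative_at[OF this] show ?thesis by metis
    qed
  qed
  then show ?case using Suc.prems by simp
qed

lemma Ck_on_mult:
  fixes f g :: "'e::euclidean_space \<Rightarrow> real"
  assumes "open S" "Ck_on k S f" "Ck_on k S g"
  shows "Ck_on k S (\<lambda>x. f x * g x)"
  using assms(2,3)
proof (induction k arbitrary: f g)
  case 0
  then show ?case by (simp add: continuous_on_mult)
next
  case (Suc k)
  have Ck: "Ck_on k S f" "Ck_on k S g"
    using Suc.prems by (auto intro: Ck_on_Suc_imp_Ck_on simp del: Ck_on.simps)
  have "Ck_on k S (\<lambda>x. frechet_derivative (\<lambda>x. f x * g x) (at x) v)" for v
  proof (rule Ck_on_cong[OF assms(1)])
    show "Ck_on k S (\<lambda>x. f x * frechet_derivative g (at x) v + frechet_derivative f (at x) v * g x)"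
      using Suc.prems by (intro Ck_on_add Suc.IH assms(1) Ck) simp_all
    show "f x * frechet_derivative g (at x) v + frechet_derivative f (at x) v * g x
        = frechet_derivative (\<lambda>x. f x * g x) (at x) v" if "x \<in> S" for x
    proof -
      have "((\<lambda>x. f x * g x) has_derivative
          (\<lambda>v. f x * frechet_derivative g (at x) v + frechet_derivative f (at x) v * g x)) (at x)"
        using Suc.prems that by (intro has_derivative_mult) (simp_all add: frechet_derivative_works)
      from frechet_derivative_at[OF this] show ?thesis by metis
    qed
  qed
  then show ?case using Suc.prems by simp
qed

lemma open_chart_image:
  "smooth_manifold A \<Longrightarrow> (U, \<phi>) \<in> A \<Longrightarrow> open (\<phi> ` U)"
  unfolding smooth_manifold_def by blast

lemma smooth_function_on_const: "smooth_function_on A W (\<lambda>x. c)"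
  unfolding smooth_function_on_def smooth_on_def comp_def by (auto simp: Ck_on_const)

lemma smooth_function_on_add:
  assumes "smooth_manifold A" "smooth_function_on A UNIV f" "smooth_function_on A UNIV g"
  shows "smooth_function_on A UNIV (\<lambda>x. f x + g x)"
  using assms(2,3) open_chart_image[OF assms(1)]
  unfolding smooth_function_on_def smooth_on_def comp_def by (fastforce intro: Ck_on_add)

lemma smooth_function_on_mult:
  assumes "smooth_manifold A" "smooth_function_on A UNIV f" "smooth_function_on A UNIV g"
  shows "smooth_function_on A UNIV (\<lambda>x. f x * g x)"
  using assms(2,3) open_chart_image[OF assms(1)]
  unfolding smooth_function_on_def smooth_on_def comp_def by (fastforce intro: Ck_on_mult)

lemma carrier_smooth_functions_iff:
  "f \<in> carrier (smooth_functions A) \<longleftrightarrow> smooth_function_on A UNIV f"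
  by (simp add: smooth_functions_def)

lemma cring_smooth_functions:
  assumes "smooth_manifold A"
  shows "cring (smooth_functions A)"
proof (rule cringI)
  show "abelian_group (smooth_functions A)"
  proof (rule abelian_groupI)
    fix f assume "f \<in> carrier (smooth_functions A)"
    then have "(\<lambda>x. - 1 * f x) \<in> carrier (smooth_functions A)"
      unfolding carrier_smooth_functions_iff
      by (intro smooth_function_on_mult[OF assms] smooth_function_on_const)
    then show "\<exists>g\<in>carrier (smooth_functions A). g \<oplus>\<^bsub>smooth_functions A\<^esub> f = \<zero>\<^bsub>smooth_functions A\<^esub>"
      by (intro bexI) (auto simp: smooth_functions_def)
  qed (auto simp: smooth_functions_def intro: smooth_function_on_add[OF assms] smooth_function_on_const)
  show "comm_monoid (smooth_functions A)"
    by (rule comm_monoidI)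
      (auto simp: smooth_functions_def intro: smooth_function_on_mult[OF assms] smooth_function_on_const)
qed (auto simp: smooth_functions_def algebra_simps)


section \<open>The module of vector fields\<close>

lemma tangent_space_add:
  "v \<in> tangent_space A x \<Longrightarrow> w \<in> tangent_space A x \<Longrightarrow> (\<lambda>f. v f + w f) \<in> tangent_space A x"
  unfolding tangent_space_def by (auto simp: algebra_simps)

lemma tangent_space_scale:
  "v \<in> tangent_space A x \<Longrightarrow> (\<lambda>f. c * v f) \<in> tangent_space A x"
  unfolding tangent_space_def by (auto simp: algebra_simps)

lemma vector_fields_simps [simp]:
  "\<zero>\<^bsub>vector_fields A\<^esub> = (\<lambda>x f. 0)"
  "X \<oplus>\<^bsub>vector_fields A\<^esub> Y = (\<lambda>x f. X x f + Y x f)"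
  "h \<odot>\<^bsub>vector_fields A\<^esub> X = (\<lambda>x f. h x * X x f)"
  by (simp_all add: vector_fields_def)

lemma vector_field_tangent:
  "X \<in> carrier (vector_fields A) \<Longrightarrow> X x \<in> tangent_space A x"
  by (simp add: vector_fields_def smooth_vector_field_on_def)

lemma vector_field_smooth:
  "X \<in> carrier (vector_fields A) \<Longrightarrow> f \<in> carrier (smooth_functions A)
    \<Longrightarrow> (\<lambda>x. X x f) \<in> carrier (smooth_functions A)"
  by (simp add: vector_fields_def smooth_vector_field_on_def carrier_smooth_functions_iff)

lemma vector_fieldI:
  assumes "\<And>x. X x \<in> tangent_space A x"
    and "\<And>f. f \<in> carrier (smooth_functions A) \<Longrightarrow> (\<lambda>x. X x f) \<in> carrier (smooth_functions A)"
  shows "X \<in> carrier (vector_fields A)"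
  using assms by (simp add: vector_fields_def smooth_vector_field_on_def carrier_smooth_functions_iff)

lemma vector_field_apply:
  assumes "X \<in> carrier (vector_fields A)"
  shows "f \<in> carrier (smooth_functions A) \<Longrightarrow> g \<in> carrier (smooth_functions A)
           \<Longrightarrow> X x (\<lambda>y. f y + g y) = X x f + X x g"
    and "f \<in> carrier (smooth_functions A) \<Longrightarrow> g \<in> carrier (smooth_functions A)
           \<Longrightarrow> X x (\<lambda>y. f y * g y) = f x * X x g + g x * X x f"
    and "f \<in> carrier (smooth_functions A) \<Longrightarrow> X x (\<lambda>y. c * f y) = c * X x f"
    and "f \<notin> carrier (smooth_functions A) \<Longrightarrow> X x f = 0"
  using vector_field_tangent[OF assms, of x] unfolding tangent_space_def by auto

lemma vector_field_zero: "X \<in> carrier (vector_fields A) \<Longrightarrow> X x (\<lambda>y. 0) = 0"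
  using vector_field_apply(3)[of X A "\<lambda>y. 0" x 0]
  by (simp add: carrier_smooth_functions_iff smooth_function_on_const)

lemma module_vector_fields:
  assumes "smooth_manifold A"
  shows "module (smooth_functions A) (vector_fields A)"
proof -
  have add_closed: "(\<lambda>x f. X x f + Y x f) \<in> carrier (vector_fields A)"
    if "X \<in> carrier (vector_fields A)" "Y \<in> carrier (vector_fields A)" for X Y
    using that
    by (auto intro!: vector_fieldI tangent_space_add[OF vector_field_tangent vector_field_tangent]
        simp: carrier_smooth_functions_iff smooth_function_on_add[OF assms]
        vector_field_smooth[unfolded carrier_smooth_functions_iff])
  have scale_closed: "(\<lambda>x f. h x * X x f) \<in> carrier (vector_fields A)"
    if "h \<in> carrier (smooth_functions A)" "X \<in> carrier (vector_fields A)" for h X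
    using that
    by (auto intro!: vector_fieldI tangent_space_scale[OF vector_field_tangent]
        simp: carrier_smooth_functions_iff smooth_function_on_mult[OF assms]
        vector_field_smooth[unfolded carrier_smooth_functions_iff])
  have zero_closed: "(\<lambda>x f. 0) \<in> carrier (vector_fields A)"
    by (rule vector_fieldI)
      (auto simp: tangent_space_def carrier_smooth_functions_iff smooth_function_on_const)
  show ?thesis
  proof (rule moduleI[OF cring_smooth_functions[OF assms]])
    show "abelian_group (vector_fields A)"
    proof (rule abelian_groupI)
      fix X assume "X \<in> carrier (vector_fields A)"
      then have "(\<lambda>x f. - 1 * X x f) \<in> carrier (vector_fields A)"
        by (intro scale_closed) (simp_all add: carrier_smooth_functions_iff smooth_function_on_const)
      then show "\<exists>Y\<in>carrier (vector_fields A). Y \<oplus>\<^bsub>vector_fields A\<^esub> X = \<zero>\<^bsub>vector_fields A\<^esub>"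
        by (intro bexI) auto
    qed (auto intro: add_closed zero_closed simp: add_ac)
  qed (auto intro: scale_closed simp: smooth_functions_def algebra_simps)
qed

lemma a_inv_vector_fields:
  assumes "smooth_manifold A" "X \<in> carrier (vector_fields A)"
  shows "\<ominus>\<^bsub>vector_fields A\<^esub> X = (\<lambda>x f. - X x f)"
proof -
  interpret module "smooth_functions A" "vector_fields A"
    by (rule module_vector_fields[OF assms(1)])
  have "(\<lambda>_. - 1) \<odot>\<^bsub>vector_fields A\<^esub> X \<in> carrier (vector_fields A)"
    using assms(2)
    by (intro smult_closed) (simp_all add: carrier_smooth_functions_iff smooth_function_on_const)
  then show ?thesis
    using assms(2) by (intro minus_equality) simp_all
qed

lemma minus_vector_fields:
  assumes "smooth_manifold A" "Y \<in> carrier (vector_fields A)"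
  shows "X \<ominus>\<^bsub>vector_fields A\<^esub> Y = (\<lambda>x f. X x f - Y x f)"
  by (simp add: a_minus_def a_inv_vector_fields[OF assms])


section \<open>The Lie bracket\<close>

text \<open>
  The cross terms \<open>X f \<cdot> Y g + X g \<cdot> Y f\<close> of \<open>X(Y(f g))\<close> are symmetric in \<open>X\<close> and \<open>Y\<close>, so they
  cancel in the commutator, which is therefore a derivation.
\<close>

lemma lie_bracket_closed:
  assumes "smooth_manifold A" and X: "X \<in> carrier (vector_fields A)"
    and Y: "Y \<in> carrier (vector_fields A)"
  shows "lie_bracket X Y \<in> carrier (vector_fields A)"
proof (rule vector_fieldI)
  have add: "(\<lambda>x. f x + g x) \<in> carrier (smooth_functions A)"
    and mult: "(\<lambda>x. f x * g x) \<in> carrier (smooth_functions A)"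
    if "f \<in> carrier (smooth_functions A)" "g \<in> carrier (smooth_functions A)" for f g
    using that smooth_function_on_add[OF assms(1)] smooth_function_on_mult[OF assms(1)]
    by (simp_all add: carrier_smooth_functions_iff)
  have const: "(\<lambda>x. c) \<in> carrier (smooth_functions A)" for c
    by (simp add: carrier_smooth_functions_iff smooth_function_on_const)
  note [simp] = vector_field_apply(1-3)[OF X] vector_field_apply(1-3)[OF Y]
    vector_field_smooth[OF X] vector_field_smooth[OF Y] add mult
  \<comment> \<open>For \<open>f\<close> not smooth, the inner field sends \<open>f\<close> to the default value \<open>0\<close> at every point, and the
    outer field is then applied to the smooth function \<open>0\<close>.\<close>
  have nonsmooth: "lie_bracket X Y x f = 0" if "f \<notin> carrier (smooth_functions A)" for x f
    using that vector_field_apply(4)[OF X] vector_field_apply(4)[OF Y]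
    by (simp add: lie_bracket_def vector_field_zero[OF X] vector_field_zero[OF Y])
  show "lie_bracket X Y x \<in> tangent_space A x" for x
    unfolding tangent_space_def
    by (auto simp: nonsmooth) (simp_all add: lie_bracket_def algebra_simps)
  fix f assume "f \<in> carrier (smooth_functions A)"
  then have "(\<lambda>x. X x (\<lambda>y. Y y f) + (- 1) * Y x (\<lambda>y. X y f)) \<in> carrier (smooth_functions A)"
    by (intro add mult const) simp_all
  then show "(\<lambda>x. lie_bracket X Y x f) \<in> carrier (smooth_functions A)"
    by (simp add: lie_bracket_def)
qed

lemma lie_bracket_swap: "lie_bracket Y X = (\<lambda>x f. - lie_bracket X Y x f)"
  by (simp add: lie_bracket_def)

lemma lie_bracket_add_right:
  assumes "Z \<in> carrier (vector_fields A)" "X \<in> carrier (vector_fields A)"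
    "Y \<in> carrier (vector_fields A)"
  shows "lie_bracket Z (X \<oplus>\<^bsub>vector_fields A\<^esub> Y)
    = lie_bracket Z X \<oplus>\<^bsub>vector_fields A\<^esub> lie_bracket Z Y"
proof (intro ext)
  fix x f
  show "lie_bracket Z (X \<oplus>\<^bsub>vector_fields A\<^esub> Y) x f
    = (lie_bracket Z X \<oplus>\<^bsub>vector_fields A\<^esub> lie_bracket Z Y) x f"
  proof (cases "f \<in> carrier (smooth_functions A)")
    case True
    then show ?thesis
      by (simp add: lie_bracket_def vector_field_apply(1)[OF assms(1)] assms vector_field_smooth)
  next
    case False
    then show ?thesis
      using assms by (simp add: lie_bracket_def vector_field_apply(4) vector_field_zero)
  qed
qed

lemma lie_bracket_smult_right:
  assumes "Z \<in> carrier (vector_fields A)" "X \<in> carrier (vector_fields A)"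
    "h \<in> carrier (smooth_functions A)"
  shows "lie_bracket Z (h \<odot>\<^bsub>vector_fields A\<^esub> X)
    = h \<odot>\<^bsub>vector_fields A\<^esub> lie_bracket Z X
      \<oplus>\<^bsub>vector_fields A\<^esub> (\<lambda>x. Z x h) \<odot>\<^bsub>vector_fields A\<^esub> X"
proof (intro ext)
  fix x f
  show "lie_bracket Z (h \<odot>\<^bsub>vector_fields A\<^esub> X) x f
    = (h \<odot>\<^bsub>vector_fields A\<^esub> lie_bracket Z X
      \<oplus>\<^bsub>vector_fields A\<^esub> (\<lambda>x. Z x h) \<odot>\<^bsub>vector_fields A\<^esub> X) x f"
  proof (cases "f \<in> carrier (smooth_functions A)")
    case True
    then show ?thesis
      using assms(3)
      by (simp add: lie_bracket_def vector_field_apply(2)[OF assms(1)] assms vector_field_smooth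
          algebra_simps)
  next
    case False
    then show ?thesis
      using assms by (simp add: lie_bracket_def vector_field_apply(4) vector_field_zero)
  qed
qed

lemma lie_bracket_minus_right:
  assumes "smooth_manifold A" "Z \<in> carrier (vector_fields A)" "X \<in> carrier (vector_fields A)"
    "Y \<in> carrier (vector_fields A)"
  shows "lie_bracket Z (X \<ominus>\<^bsub>vector_fields A\<^esub> Y)
    = lie_bracket Z X \<ominus>\<^bsub>vector_fields A\<^esub> lie_bracket Z Y"
proof -
  interpret module "smooth_functions A" "vector_fields A"
    by (rule module_vector_fields[OF assms(1)])
  have "lie_bracket Z X = lie_bracket Z ((X \<ominus>\<^bsub>vector_fields A\<^esub> Y) \<oplus>\<^bsub>vector_fields A\<^esub> Y)"
    using assms by (simp add: minus_vector_fields)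
  also have "\<dots> = lie_bracket Z (X \<ominus>\<^bsub>vector_fields A\<^esub> Y) \<oplus>\<^bsub>vector_fields A\<^esub> lie_bracket Z Y"
    using assms by (intro lie_bracket_add_right) simp_all
  finally show ?thesis
    using assms by (simp add: minus_vector_fields lie_bracket_closed)
qed


section \<open>Quotients of modules\<close>

lemma (in module) submodule_imp_abelian_subgroup:
  assumes "submodule H R M"
  shows "abelian_subgroup H M"
  using assms by (intro abelian_subgroupI3 additive_subgroupI submodule.axioms(1) M.abelian_group_axioms)

lemma (in abelian_subgroup) a_r_coset_eq_iff:
  assumes "x \<in> carrier G" "y \<in> carrier G"
  shows "H +> x = H +> y \<longleftrightarrow> x \<ominus> y \<in> H"
proof
  assume "H +> x = H +> y"
  then have "x \<in> H +> y" using a_rcos_self[OF assms(1)] by simp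
  then show "x \<ominus> y \<in> H"
    using a_rcos_module_imp assms unfolding a_minus_def by blast
next
  assume "x \<ominus> y \<in> H"
  then have "x \<in> H +> y"
    using a_rcos_module_rev assms unfolding a_minus_def by blast
  then show "H +> x = H +> y"
    using a_repr_independence'[OF _ assms(2)] by simp
qed

text \<open>
  The union that defines the scalar product of a coset ranges over all representatives, which
  differ by elements of \<open>H\<close>. All the cosets in it coincide because \<open>H\<close> is closed under scalars.
\<close>

lemma quotient_module_smult:
  assumes "module R M" "submodule H R M" "a \<in> carrier R" "x \<in> carrier M"
  shows "a \<odot>\<^bsub>quotient_module M H\<^esub> (H +>\<^bsub>M\<^esub> x) = H +>\<^bsub>M\<^esub> (a \<odot>\<^bsub>M\<^esub> x)"
proof -
  interpret module R M by fact
  interpret submodule H R M by fact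
  interpret H: abelian_subgroup H M by (rule submodule_imp_abelian_subgroup) fact
  have "H +>\<^bsub>M\<^esub> (a \<odot>\<^bsub>M\<^esub> y) = H +>\<^bsub>M\<^esub> (a \<odot>\<^bsub>M\<^esub> x)" if y: "y \<in> H +>\<^bsub>M\<^esub> x" for y
  proof -
    obtain h where h: "h \<in> H" and "y = h \<oplus>\<^bsub>M\<^esub> x"
      using y unfolding a_r_coset_def' by blast
    then have "a \<odot>\<^bsub>M\<^esub> y = a \<odot>\<^bsub>M\<^esub> h \<oplus>\<^bsub>M\<^esub> a \<odot>\<^bsub>M\<^esub> x"
      using assms by (simp add: smult_r_distr)
    then have "a \<odot>\<^bsub>M\<^esub> y \<in> H +>\<^bsub>M\<^esub> (a \<odot>\<^bsub>M\<^esub> x)"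
      using assms h by (auto intro: M.a_rcosI H.a_subset[THEN subsetD] simp: a_r_coset_def')
    then show ?thesis
      using assms by (intro H.a_repr_independence'[symmetric]) simp_all
  qed
  moreover have "x \<in> H +>\<^bsub>M\<^esub> x"
    using assms(4) by (rule H.a_rcos_self)
  ultimately have "(\<Union>y\<in>H +>\<^bsub>M\<^esub> x. H +>\<^bsub>M\<^esub> (a \<odot>\<^bsub>M\<^esub> y)) = H +>\<^bsub>M\<^esub> (a \<odot>\<^bsub>M\<^esub> x)"
    by blast
  then show ?thesis
    by (simp add: quotient_module_def)
qed


section \<open>Distributions and curvature\<close>

text \<open>
  Each \<open>E x\<close> is the span of a frame at \<open>x\<close>. Coefficient vectors are extensional functions on
  \<open>{..<k}\<close>, so a sum of two of them has to be restricted before it is one again; the linear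
  combination is the same.
\<close>

lemma vector_subbundle_linear:
  assumes "vector_subbundle A k E"
  shows "(\<lambda>f. 0) \<in> E x"
    and "v \<in> E x \<Longrightarrow> w \<in> E x \<Longrightarrow> (\<lambda>f. v f + w f) \<in> E x"
    and "v \<in> E x \<Longrightarrow> (\<lambda>f. a * v f) \<in> E x"
proof -
  obtain X where "bij_betw (\<lambda>c f. \<Sum>i<k. c i * X i x f) ({..<k} \<rightarrow>\<^sub>E (UNIV :: real set)) (E x)"
    using assms unfolding vector_subbundle_def by blast
  then have E: "E x = (\<lambda>c f. \<Sum>i<k. c i * X i x f) ` ({..<k} \<rightarrow>\<^sub>E (UNIV :: real set))"
    by (simp add: bij_betw_imp_surj_on)
  have mem: "(\<lambda>f. \<Sum>i<k. c i * X i x f) \<in> E x" for c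
    unfolding E by (rule image_eqI[where x = "restrict c {..<k}"]) auto
  have ex: "\<exists>c. v = (\<lambda>f. \<Sum>i<k. c i * X i x f)" if "v \<in> E x" for v
    using that unfolding E by blast
  show "(\<lambda>f. 0) \<in> E x"
    using mem[of "\<lambda>i. 0"] by simp
  show "(\<lambda>f. v f + w f) \<in> E x" if "v \<in> E x" "w \<in> E x"
  proof -
    obtain c d where "v = (\<lambda>f. \<Sum>i<k. c i * X i x f)" "w = (\<lambda>f. \<Sum>i<k. d i * X i x f)"
      using ex \<open>v \<in> E x\<close> \<open>w \<in> E x\<close> by metis
    then show ?thesis
      using mem[of "\<lambda>i. c i + d i"] by (simp add: sum.distrib algebra_simps)
  qed
  show "(\<lambda>f. a * v f) \<in> E x" if "v \<in> E x"
  proof -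
    obtain c where "v = (\<lambda>f. \<Sum>i<k. c i * X i x f)"
      using ex \<open>v \<in> E x\<close> by metis
    then show ?thesis
      using mem[of "\<lambda>i. a * c i"] by (simp add: sum_distrib_left algebra_simps)
  qed
qed

lemma submodule_distribution:
  assumes "smooth_manifold A" "distribution A k D"
  shows "submodule D (smooth_functions A) (vector_fields A)"
proof -
  interpret module "smooth_functions A" "vector_fields A"
    by (rule module_vector_fields[OF assms(1)])
  have D: "X \<in> D \<longleftrightarrow> X \<in> carrier (vector_fields A) \<and> (\<forall>x. X x \<in> values_at D x)" for X
    using assms(2) unfolding distribution_def by blast
  have E: "vector_subbundle A k (values_at D)"
    using assms(2) unfolding distribution_def by blast
  note linear = vector_subbundle_linear[OF E]
  show ?thesis
  proof (rule submoduleI)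
    show "D \<subseteq> carrier (vector_fields A)"
      using D by blast
    show "\<zero>\<^bsub>vector_fields A\<^esub> \<in> D"
      unfolding D using zero_closed linear(1) by simp
    fix X assume X: "X \<in> D"
    then have X': "X \<in> carrier (vector_fields A)" by (simp add: D)
    show "\<ominus>\<^bsub>vector_fields A\<^esub> X \<in> D"
      unfolding D
      using X a_inv_closed[OF X'] linear(3)[of "X x" x "- 1" for x]
      by (simp add: D a_inv_vector_fields[OF assms(1) X'])
    show "X \<oplus>\<^bsub>vector_fields A\<^esub> Y \<in> D" if "Y \<in> D" for Y
      using X that a_closed[of X Y] linear(2) by (simp add: D)
    show "h \<odot>\<^bsub>vector_fields A\<^esub> X \<in> D" if "h \<in> carrier (smooth_functions A)" for h
      using X that smult_closed[of h X] linear(3) by (simp add: D)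
  qed
qed

lemma class_mod_eq_iff:
  assumes "smooth_manifold A" "distribution A k D"
    and "X \<in> carrier (vector_fields A)" "Y \<in> carrier (vector_fields A)"
  shows "class_mod A D X = class_mod A D Y \<longleftrightarrow> X \<ominus>\<^bsub>vector_fields A\<^esub> Y \<in> D"
proof -
  interpret module "smooth_functions A" "vector_fields A"
    by (rule module_vector_fields[OF assms(1)])
  interpret D: abelian_subgroup D "vector_fields A"
    by (rule submodule_imp_abelian_subgroup[OF submodule_distribution[OF assms(1,2)]])
  show ?thesis
    unfolding class_mod_def using assms by (intro D.a_r_coset_eq_iff)
qed

lemma class_mod_add:
  assumes "smooth_manifold A" "distribution A k D"
    and "X \<in> carrier (vector_fields A)" "Y \<in> carrier (vector_fields A)"
  shows "class_mod A D (X \<oplus>\<^bsub>vector_fields A\<^esub> Y)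
    = class_mod A D X \<oplus>\<^bsub>normal_module A D\<^esub> class_mod A D Y"
proof -
  interpret module "smooth_functions A" "vector_fields A"
    by (rule module_vector_fields[OF assms(1)])
  interpret D: abelian_subgroup D "vector_fields A"
    by (rule submodule_imp_abelian_subgroup[OF submodule_distribution[OF assms(1,2)]])
  show ?thesis
    using D.a_rcos_sum[OF assms(3,4)]
    by (simp add: class_mod_def normal_module_def quotient_module_def del: vector_fields_simps)
qed

lemma class_mod_smult:
  assumes "smooth_manifold A" "distribution A k D"
    and "h \<in> carrier (smooth_functions A)" "X \<in> carrier (vector_fields A)"
  shows "class_mod A D (h \<odot>\<^bsub>vector_fields A\<^esub> X) = h \<odot>\<^bsub>normal_module A D\<^esub> class_mod A D X"
  unfolding class_mod_def normal_module_def
  using quotient_module_smult[OF module_vector_fields submodule_distribution] assms by metis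

lemma carrier_normal_module:
  "carrier (normal_module A D) = class_mod A D ` carrier (vector_fields A)"
  unfolding normal_module_def quotient_module_def class_mod_def A_RCOSETS_def' by auto

text \<open>
  This is where the derivation term \<open>Z(h) X\<close> of the bracket is absorbed: it lies in \<open>D\<close>, so it
  does not change the class. For \<open>Z\<close> in \<open>D\<close> the map is the curvature form with first argument \<open>Z\<close>.
\<close>

lemma class_mod_lie_bracket_hom:
  assumes "smooth_manifold A" "distribution A k D" and Z: "Z \<in> carrier (vector_fields A)"
  shows "(\<lambda>X\<in>D. class_mod A D (lie_bracket Z X)) \<in>
    carrier (hom_module (smooth_functions A) (distribution_module A D) (normal_module A D))"
proof -
  interpret module "smooth_functions A" "vector_fields A"
    by (rule module_vector_fields[OF assms(1)])
  note D = submodule_distribution[OF assms(1,2)]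
  note DE = submoduleE[OF D]
  have vf: "X \<in> carrier (vector_fields A)" if "X \<in> D" for X
    using DE(1) that by blast
  note bracket = lie_bracket_closed[OF assms(1) Z vf]
  have "class_mod A D (lie_bracket Z (X \<oplus>\<^bsub>vector_fields A\<^esub> Y))
      = class_mod A D (lie_bracket Z X) \<oplus>\<^bsub>normal_module A D\<^esub> class_mod A D (lie_bracket Z Y)"
    if "X \<in> D" "Y \<in> D" for X Y
    using that by (simp only: lie_bracket_add_right Z vf class_mod_add[OF assms(1,2)] bracket)
  moreover have "class_mod A D (lie_bracket Z (h \<odot>\<^bsub>vector_fields A\<^esub> X))
      = h \<odot>\<^bsub>normal_module A D\<^esub> class_mod A D (lie_bracket Z X)"
    if h: "h \<in> carrier (smooth_functions A)" and X: "X \<in> D" for h X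
  proof -
    have Zh: "(\<lambda>x. Z x h) \<odot>\<^bsub>vector_fields A\<^esub> X \<in> D"
      by (rule DE(4)[OF vector_field_smooth[OF Z h] X])
    have hZ: "h \<odot>\<^bsub>vector_fields A\<^esub> lie_bracket Z X \<in> carrier (vector_fields A)"
      by (rule smult_closed[OF h bracket[OF X]])
    have "(h \<odot>\<^bsub>vector_fields A\<^esub> lie_bracket Z X \<oplus>\<^bsub>vector_fields A\<^esub> (\<lambda>x. Z x h) \<odot>\<^bsub>vector_fields A\<^esub> X)
        \<ominus>\<^bsub>vector_fields A\<^esub> (h \<odot>\<^bsub>vector_fields A\<^esub> lie_bracket Z X) \<in> D"
      using Zh by (simp add: minus_vector_fields[OF assms(1) hZ, simplified])
    then have "class_mod A D (lie_bracket Z (h \<odot>\<^bsub>vector_fields A\<^esub> X))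
        = class_mod A D (h \<odot>\<^bsub>vector_fields A\<^esub> lie_bracket Z X)"
      unfolding lie_bracket_smult_right[OF Z vf[OF X] h]
      by (intro class_mod_eq_iff[OF assms(1,2), THEN iffD2] a_closed hZ vf[OF Zh])
    also have "\<dots> = h \<odot>\<^bsub>normal_module A D\<^esub> class_mod A D (lie_bracket Z X)"
      by (rule class_mod_smult[OF assms(1,2) h bracket[OF X]])
    finally show ?thesis .
  qed
  ultimately show ?thesis
    using DE(4,5) bracket
    by (auto simp: hom_module_def module_homs_def distribution_module_def carrier_normal_module
        simp del: vector_fields_simps)
qed


section \<open>Contact vector fields\<close>

text \<open>
  The difference \<open>Y\<close> of two symmetries in one class lies in \<open>D\<close> and, being a symmetry, satisfies
  \<open>R(Y, \<cdot>) = 0 = R(0, \<cdot>)\<close>. Nondegeneracy then gives \<open>Y = 0\<close>.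
\<close>

lemma inj_on_class_mod_symmetries:
  assumes "smooth_manifold A" "distribution A k D" "nondegenerate A D"
  shows "inj_on (class_mod A D) (infinitesimal_symmetries A D)"
proof (rule inj_onI)
  interpret module "smooth_functions A" "vector_fields A"
    by (rule module_vector_fields[OF assms(1)])
  note D = submodule_distribution[OF assms(1,2)]
  note DE = submoduleE[OF D]
  fix Z W
  assume Z: "Z \<in> infinitesimal_symmetries A D" and W: "W \<in> infinitesimal_symmetries A D"
    and eq: "class_mod A D Z = class_mod A D W"
  define Y where "Y = Z \<ominus>\<^bsub>vector_fields A\<^esub> W"
  have vf: "Z \<in> carrier (vector_fields A)" "W \<in> carrier (vector_fields A)"
    using Z W by (auto simp: infinitesimal_symmetries_def)
  have YD: "Y \<in> D"
    using eq vf by (simp add: Y_def class_mod_eq_iff[OF assms(1,2)])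
  have ZD: "\<zero>\<^bsub>vector_fields A\<^esub> \<in> D"
    using D submodule_imp_abelian_subgroup additive_subgroup.zero_closed abelian_subgroup_def by blast
  have "curvature A D Y X = curvature A D \<zero>\<^bsub>vector_fields A\<^esub> X" if X: "X \<in> D" for X
  proof -
    have Xvf: "X \<in> carrier (vector_fields A)" using X DE(1) by blast
    have "lie_bracket X Y \<in> D"
      using Z W X DE(3,5) lie_bracket_minus_right[OF assms(1) Xvf vf]
      by (simp add: Y_def infinitesimal_symmetries_def a_minus_def)
    then have "\<ominus>\<^bsub>vector_fields A\<^esub> lie_bracket X Y \<in> D"
      by (rule DE(3))
    moreover have "lie_bracket X Y \<in> carrier (vector_fields A)"
      using Xvf YD DE(1) by (intro lie_bracket_closed[OF assms(1)]) auto
    ultimately have "lie_bracket Y X \<in> D"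
      by (simp add: a_inv_vector_fields[OF assms(1)] lie_bracket_swap[of Y X])
    moreover have "lie_bracket \<zero>\<^bsub>vector_fields A\<^esub> X = \<zero>\<^bsub>vector_fields A\<^esub>"
      by (simp add: lie_bracket_def vector_field_zero[OF Xvf])
    ultimately have "lie_bracket Y X \<ominus>\<^bsub>vector_fields A\<^esub> lie_bracket \<zero>\<^bsub>vector_fields A\<^esub> X \<in> D"
      by (simp only: minus_vector_fields[OF assms(1) zero_closed]) simp
    then show ?thesis
      unfolding curvature_def
      using lie_bracket_closed[OF assms(1)] Xvf YD ZD DE(1)
      by (intro class_mod_eq_iff[OF assms(1,2), THEN iffD2]) blast+
  qed
  then have "(\<lambda>X\<in>D. curvature A D Y X) = (\<lambda>X\<in>D. curvature A D \<zero>\<^bsub>vector_fields A\<^esub> X)"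
    by (intro restrict_ext)
  moreover have "inj_on (\<lambda>X. \<lambda>Y\<in>D. curvature A D X Y) D"
    using assms(3)
    by (simp add: nondegenerate_def module_isos_def bij_betw_def distribution_module_def)
  ultimately have "Y = \<zero>\<^bsub>vector_fields A\<^esub>"
    using YD ZD by (auto dest: inj_onD)
  then show "Z = W"
    using vf by (simp add: Y_def minus_vector_fields[OF assms(1)] fun_eq_iff)
qed

text \<open>
  A symmetry in the class of \<open>Z\<close> is \<open>Z - Y\<close>, where \<open>Y\<close> in \<open>D\<close> has the same brackets with \<open>D\<close> as \<open>Z\<close>,
  modulo \<open>D\<close>.
\<close>

lemma class_mod_symmetries_surj:
  assumes "smooth_manifold A" "distribution A k D" "nondegenerate A D"
  shows "class_mod A D ` infinitesimal_symmetries A D = carrier (normal_module A D)"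
proof
  show "class_mod A D ` infinitesimal_symmetries A D \<subseteq> carrier (normal_module A D)"
    unfolding carrier_normal_module infinitesimal_symmetries_def by blast
  interpret module "smooth_functions A" "vector_fields A"
    by (rule module_vector_fields[OF assms(1)])
  note DE = submoduleE[OF submodule_distribution[OF assms(1,2)]]
  show "carrier (normal_module A D) \<subseteq> class_mod A D ` infinitesimal_symmetries A D"
  proof
    fix C assume "C \<in> carrier (normal_module A D)"
    then obtain Z where Z: "Z \<in> carrier (vector_fields A)" and C: "C = class_mod A D Z"
      unfolding carrier_normal_module by blast
    have "(\<lambda>X. \<lambda>Y\<in>D. curvature A D X Y) ` D
        = carrier (hom_module (smooth_functions A) (distribution_module A D) (normal_module A D))"
      using assms(3)
      by (simp add: nondegenerate_def module_isos_def bij_betw_def distribution_module_def)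
    with class_mod_lie_bracket_hom[OF assms(1,2) Z]
    obtain Y where Y: "Y \<in> D"
      and eq: "(\<lambda>X\<in>D. class_mod A D (lie_bracket Z X)) = (\<lambda>X\<in>D. curvature A D Y X)"
      by (metis (no_types, lifting) imageE)
    have Yvf: "Y \<in> carrier (vector_fields A)" using Y DE(1) by blast
    define W where "W = Z \<ominus>\<^bsub>vector_fields A\<^esub> Y"
    have W: "W \<in> carrier (vector_fields A)"
      unfolding W_def using Z Yvf by (rule M.minus_closed)
    have "lie_bracket X W \<in> D" if X: "X \<in> D" for X
    proof -
      have Xvf: "X \<in> carrier (vector_fields A)" using X DE(1) by blast
      have "class_mod A D (lie_bracket Y X) = class_mod A D (lie_bracket Z X)"
        using fun_cong[OF eq, of X] X by (simp add: curvature_def)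
      then have "lie_bracket Y X \<ominus>\<^bsub>vector_fields A\<^esub> lie_bracket Z X \<in> D"
        using class_mod_eq_iff[OF assms(1,2)] lie_bracket_closed[OF assms(1)] Xvf Yvf Z by blast
      also have "lie_bracket Y X \<ominus>\<^bsub>vector_fields A\<^esub> lie_bracket Z X
          = lie_bracket X Z \<ominus>\<^bsub>vector_fields A\<^esub> lie_bracket X Y"
        using lie_bracket_closed[OF assms(1)] Xvf Yvf Z
        by (simp add: minus_vector_fields[OF assms(1)])
          (simp add: lie_bracket_swap[of Y X] lie_bracket_swap[of Z X] fun_eq_iff)
      also have "\<dots> = lie_bracket X W"
        unfolding W_def using lie_bracket_minus_right[OF assms(1) Xvf Z Yvf] by simp
      finally show ?thesis .
    qed
    then have "W \<in> infinitesimal_symmetries A D"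
      using W by (simp add: infinitesimal_symmetries_def)
    moreover have "Z \<ominus>\<^bsub>vector_fields A\<^esub> W = Y"
      using W by (simp add: minus_vector_fields[OF assms(1)]) (simp add: W_def minus_vector_fields[OF assms(1) Yvf])
    then have "C = class_mod A D W"
      using Y Z W C class_mod_eq_iff[OF assms(1,2) Z W] by simp
    ultimately show "C \<in> class_mod A D ` infinitesimal_symmetries A D"
      by blast
  qed
qed

theorem proposition2p1:
  fixes A :: "('a::{t2_space, second_countable_topology}, 'e::euclidean_space) chart set"
    and D :: "('a \<Rightarrow> 'a tangent) set"
  assumes "smooth_manifold A"
    and "contact_structure A D"
  shows "(\<forall>Z\<in>infinitesimal_symmetries A D. \<forall>W\<in>infinitesimal_symmetries A D.
            class_mod A D (Z \<oplus>\<^bsub>vector_fields A\<^esub> W)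
              = class_mod A D Z \<oplus>\<^bsub>normal_module A D\<^esub> class_mod A D W) \<and>
         (\<forall>c::real. \<forall>Z\<in>infinitesimal_symmetries A D.
            class_mod A D ((\<lambda>_. c) \<odot>\<^bsub>vector_fields A\<^esub> Z)
              = (\<lambda>_. c) \<odot>\<^bsub>normal_module A D\<^esub> class_mod A D Z) \<and>
         bij_betw (class_mod A D) (infinitesimal_symmetries A D) (carrier (normal_module A D))"
proof -
  obtain k where D: "distribution A k D" and nd: "nondegenerate A D"
    using assms(2) unfolding contact_structure_def by blast
  have sub: "infinitesimal_symmetries A D \<subseteq> carrier (vector_fields A)"
    by (auto simp: infinitesimal_symmetries_def)
  have const: "(\<lambda>_. c) \<in> carrier (smooth_functions A)" for c
    by (simp add: carrier_smooth_functions_iff smooth_function_on_const)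
  show ?thesis
  proof (intro conjI ballI allI)
    fix Z W assume "Z \<in> infinitesimal_symmetries A D" "W \<in> infinitesimal_symmetries A D"
    then show "class_mod A D (Z \<oplus>\<^bsub>vector_fields A\<^esub> W)
        = class_mod A D Z \<oplus>\<^bsub>normal_module A D\<^esub> class_mod A D W"
      using sub by (intro class_mod_add[OF assms(1) D]) auto
  next
    fix c :: real and Z assume "Z \<in> infinitesimal_symmetries A D"
    then show "class_mod A D ((\<lambda>_. c) \<odot>\<^bsub>vector_fields A\<^esub> Z)
        = (\<lambda>_. c) \<odot>\<^bsub>normal_module A D\<^esub> class_mod A D Z"
      using sub by (intro class_mod_smult[OF assms(1) D const]) auto
  next
    show "bij_betw (class_mod A D) (infinitesimal_symmetries A D) (carrier (normal_module A D))"
      using inj_on_class_mod_symmetries[OF assms(1) D nd] class_mod_symmetries_surj[OF assms(1) D nd]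
      by (simp add: bij_betw_def)
  qed
qed

end
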